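(* Let $\mathbb{M}\subset\mathbb{R}^d$ be a bounded domain with Lipschitz boundary, $\mathcal X$ a Banach space, $\mathfrak B\subset\mathcal X$ a bounded, closed and convex subset, and $F:\mathfrak B\to L^1(\mathbb{M})$ an operator such that $F(u)\ge0$ a.e. for all $u\in\mathfrak B$ and such that, for some $s>\frac d2$, $F(\mathfrak B)$ is a bounded subset of $H^s(\mathbb{M})$. Put $R:=\sup_{u\in\mathfrak B}\|F(u)\|_{H^s(\mathbb{M})}<\infty$ and assume $R>0$. Let $u^\dagger\in\mathfrak B$, $g^\dagger:=F(u^\dagger)$, and $\sigma>0$. For $t>0$ let $\tilde G_t$ be a Poisson process on $\mathbb{M}$ with intensity $tg^\dagger$, $G_t:=\frac1t\tilde G_t$, and for $g\in F(\mathfrak B)$ define $$\mathcal S(G_t;g):=\int_{\mathbb{M}}g\,\mathrm dx-\int_{\mathbb{M}}\ln(g+\sigma)\,(\mathrm dG_t+\sigma\,\mathrm dx),$$ $$\mathcal T(g^\dagger;g):=\int_{\mathbb{M}}\left[g-g^\dagger-(g^\dagger+\sigma)\ln\frac{g+\sigma}{g^\dagger+\sigma}\right]\mathrm dx .$$ Let $\mathcal R:\mathcal X\to(-\infty,\infty]$ be a proper convex functional and suppose there exist $u^*\in\partial\mathcal R(u^\dagger)$, $\beta\in[\frac12,\infty)$ and an index function $\varphi$ such that $\varphi^2$ is concave and $$\beta\,\mathcal D_{\mathcal R}^{u^*}(u,u^\dagger)\le\mathcal R(u)-\mathcal R(u^\dagger)+\varphi\left(\mathcal T(g^\dagger;F(u))\right)\qquad\text{for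 all }u\in\mathfrak B.$$ Suppose there are constants $C_{\rm bd}>0$ and $q\ge1$ with $$\|u-u^\dagger\|_{\mathcal X}^q\le C_{\rm bd}\,\mathcal D_{\mathcal R}^{u^*}(u,u^\dagger)\qquad\text{for all }u\in\mathfrak B.$$ Suppose that $u\mapsto\mathcal S(G_t;F(u))+\alpha\mathcal R(u)$ has a global minimizer over $\mathfrak B$ for $\alpha>0$, and let $u_\alpha$ denote such a minimizer. Let $r>1$ and $$\tau\ge\tfrac14 R\max\left\{\sigma^{-\lfloor s\rfloor-1},|\ln R|\right\}C_{\rm conc},$$ where $C_{\rm conc}\ge1$ is a concentration constant as described in the context. Define $$\alpha_j:=\frac{\tau\ln(t)}{\sqrt t}\,r^{2j-2},\qquad j\in\mathbb N=\{1,2,\dots\},$$ and $m:=\min\{j\in\mathbb N:\alpha_j\ge1\}$. Then the choice $$j_{\rm bal}:=\max\left\{j\in\{1,\dots,m\}\;:\;\|u_{\alpha_i}-u_{\alpha_j}\|_{\mathcal X}\le4\,(4C_{\rm bd})^{\frac1q}\,r^{\frac{2-2i}{q}}\ \text{ for all } i<j\right\}$$ yields $$\mathbf E\left[\|u_{\alpha_{j_{\rm bal}}}-u^\dagger\|_{\mathcal X}^q\right]=\mathcal O\left(\varphi\left(\frac{\ln t}{\sqrt t}\right)\right)\qquad\text{as }t\to\infty.$$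
   Context: A Poisson process on $\mathbb{M}$ with intensity $h\in L^1(\mathbb{M})$, $h\ge0$, is a random finite sum of point masses $G=\sum_{i=1}^N\delta_{x_i}$ such that $\mathbf E[G(\mathbb{M}')]=\int_{\mathbb{M}'}h\,\mathrm dx$ for every measurable $\mathbb{M}'\subset\mathbb{M}$ and $G(\mathbb{M}'_1),\dots,G(\mathbb{M}'_m)$ are independent for disjoint measurable $\mathbb{M}'_1,\dots,\mathbb{M}'_m$. Thus $\int\psi\,\mathrm dG_t=\frac1t\sum_{i}\psi(x_i)$ with $x_i$ the points of $\tilde G_t$. Elements of $H^s(\mathbb{M})$, $s>d/2$, are identified with their continuous representatives. The minimizers $u_\alpha$ depend on $G_t$ and are assumed to be selected so that the expectation is defined (measurability). Concentration constant: with $Z(g):=\left|\int_{\mathbb{M}}\ln(g+\sigma)\,(\mathrm dG_t-g^\dagger\,\mathrm dx)\right|$ and $K:=R\max\{\sigma^{-\lfloor s\rfloor-1},|\ln R|\}\,C_{\rm conc}$, the constant $C_{\rm conc}\ge1$ (independent of $t$ and $\rho$) is such that $$\mathbf P\left[\sup_{u\in\mathfrak B}Z(F(u))\le\frac{\rho}{\sqrt t}\right]\ge1-\exp\left(-\frac{\rho}{K}\right)\qquad\text{for all }t\ge1,\ \rho\ge K .$$ $u^*\in\partial\mathcal R(u^\dagger)\subset\mathcal X^*$ means $\mathcal R(u^\dagger)<\infty$ and $\mathcal R(u)\ge\mathcal R(u^\dagger)+\langle u^*,u-u^\dagger\rangle$ for all $u\in\mathcal X$; the Bregman distance is $\mathcal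 D_{\mathcal R}^{u^*}(u,u^\dagger):=\mathcal R(u)-\mathcal R(u^\dagger)-\langle u^*,u-u^\dagger\rangle$. An index function is a (finite) monotonically increasing function $\varphi:[0,\infty)\to[0,\infty)$ with $\varphi(0)=0$, not identically zero. *)

theory Defs
  imports "HOL-Probability.Probability" "HOL-Library.Landau_Symbols" "HOL-Library.Multiset"
begin

section \<open>Bounded Lipschitz domains\<close>

text \<open>
  Near each boundary point, and after a choice of a vertical unit direction \<open>e\<close>, the set lies
  strictly above the graph of a Lipschitz function \<open>\<gamma>\<close> defined on the hyperplane orthogonal
  to \<open>e\<close>; \<open>x - (x \<bullet> e) *\<^sub>R e\<close> is the orthogonal projection of \<open>x\<close> onto that hyperplane.
\<close>

definition lipschitz_boundary :: "'a::euclidean_space set \<Rightarrow> bool" where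
  "lipschitz_boundary M \<longleftrightarrow>
     (\<forall>p\<in>frontier M. \<exists>\<epsilon>>0. \<exists>e C \<gamma>. norm e = 1 \<and> C-lipschitz_on {y. y \<bullet> e = 0} \<gamma> \<and>
        M \<inter> ball p \<epsilon> = {x \<in> ball p \<epsilon>. \<gamma> (x - (x \<bullet> e) *\<^sub>R e) < x \<bullet> e})"

definition bounded_lipschitz_domain :: "'a::euclidean_space set \<Rightarrow> bool" where
  "bounded_lipschitz_domain M \<longleftrightarrow>
     open M \<and> connected M \<and> M \<noteq> {} \<and> bounded M \<and> lipschitz_boundary M"


section \<open>Sobolev spaces of real order\<close>

text \<open>
  Multi-indices are finite multisets \<open>\<alpha>\<close> of elements of \<open>Basis\<close>: the multiplicity of a basis
  vector \<open>b\<close> is the number of derivatives taken in direction \<open>b\<close>, and \<open>size \<alpha>\<close> is the order.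
\<close>

definition multi_indices :: "nat \<Rightarrow> 'a::euclidean_space multiset set" where
  "multi_indices k = {\<alpha>. set_mset \<alpha> \<subseteq> Basis \<and> size \<alpha> = k}"

fun iter_partial :: "'a::euclidean_space list \<Rightarrow> ('a \<Rightarrow> real) \<Rightarrow> 'a \<Rightarrow> real" where
  "iter_partial [] f = f"
| "iter_partial (b # bs) f = (\<lambda>x. frechet_derivative (iter_partial bs f) (at x) b)"

text \<open>Smooth functions with compact support in \<open>M\<close>.\<close>

definition test_function :: "'a::euclidean_space set \<Rightarrow> ('a \<Rightarrow> real) \<Rightarrow> bool" where
  "test_function M \<phi> \<longleftrightarrow>
     (\<forall>bs. set bs \<subseteq> Basis \<longrightarrow> iter_partial bs \<phi> differentiable_on UNIV) \<and>
     (\<exists>K. compact K \<and> K \<subseteq> M \<and> (\<forall>x. x \<notin> K \<longrightarrow> \<phi> x = 0))"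

definition locally_integrable_on :: "('a::euclidean_space \<Rightarrow> real) \<Rightarrow> 'a set \<Rightarrow> bool" where
  "locally_integrable_on f M \<longleftrightarrow> (\<forall>K. compact K \<and> K \<subseteq> M \<longrightarrow> integrable (lebesgue_on K) f)"

text \<open>
  The quantification over all lists \<open>bs\<close> enumerating \<open>\<alpha>\<close> is harmless, since iterated partial
  derivatives of a test function do not depend on the order of differentiation.
\<close>

definition has_weak_deriv ::
  "'a::euclidean_space set \<Rightarrow> 'a multiset \<Rightarrow> ('a \<Rightarrow> real) \<Rightarrow> ('a \<Rightarrow> real) \<Rightarrow> bool" where
  "has_weak_deriv M \<alpha> f g \<longleftrightarrow>
     locally_integrable_on f M \<and> locally_integrable_on g M \<and>
     (\<forall>\<phi> bs. test_function M \<phi> \<longrightarrow> mset bs = \<alpha> \<longrightarrow>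
        (\<integral>x. f x * iter_partial bs \<phi> x \<partial>lebesgue_on M) =
        (- 1) ^ size \<alpha> * (\<integral>x. g x * \<phi> x \<partial>lebesgue_on M))"

text \<open>Weak derivatives are unique up to null sets, so that the choice is immaterial below.\<close>

definition weak_deriv ::
  "'a::euclidean_space set \<Rightarrow> 'a multiset \<Rightarrow> ('a \<Rightarrow> real) \<Rightarrow> 'a \<Rightarrow> real" where
  "weak_deriv M \<alpha> f = (SOME g. has_weak_deriv M \<alpha> f g)"

text \<open>
  The squared Sobolev--Slobodeckij norm of order \<open>s \<ge> 0\<close>: the squared \<open>L\<^sup>2\<close>-norms of all weak
  derivatives of order at most \<open>\<lfloor>s\<rfloor>\<close> and, for fractional \<open>s\<close>, the squared Gagliardo seminorms of
  order \<open>frac s\<close> of the weak derivatives of order \<open>\<lfloor>s\<rfloor>\<close>.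
\<close>

definition sobolev_norm_sq ::
  "'a::euclidean_space set \<Rightarrow> real \<Rightarrow> ('a \<Rightarrow> real) \<Rightarrow> ennreal" where
  "sobolev_norm_sq M s f =
     (\<Sum>k\<le>nat \<lfloor>s\<rfloor>. \<Sum>\<alpha>\<in>multi_indices k.
        \<integral>\<^sup>+x. ennreal ((weak_deriv M \<alpha> f x)\<^sup>2) \<partial>lebesgue_on M) +
     (if frac s = 0 then 0 else
       (\<Sum>\<alpha>\<in>multi_indices (nat \<lfloor>s\<rfloor>).
         \<integral>\<^sup>+x. (\<integral>\<^sup>+y.
            ennreal ((weak_deriv M \<alpha> f x - weak_deriv M \<alpha> f y)\<^sup>2 /
                     norm (x - y) powr (real DIM('a) + 2 * frac s))
          \<partial>lebesgue_on M) \<partial>lebesgue_on M))"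

definition sobolev_space :: "'a::euclidean_space set \<Rightarrow> real \<Rightarrow> ('a \<Rightarrow> real) set" where
  "sobolev_space M s =
     {f. (\<forall>k\<le>nat \<lfloor>s\<rfloor>. \<forall>\<alpha>\<in>multi_indices k. \<exists>g. has_weak_deriv M \<alpha> f g) \<and>
         sobolev_norm_sq M s f < \<infinity>}"

definition sobolev_norm :: "'a::euclidean_space set \<Rightarrow> real \<Rightarrow> ('a \<Rightarrow> real) \<Rightarrow> real" where
  "sobolev_norm M s f = sqrt (enn2real (sobolev_norm_sq M s f))"


section \<open>Poisson processes and Poisson data\<close>

text \<open>
  A finite sum of point masses is represented by the finite multiset of its atoms.
\<close>

definition point_count :: "'a multiset \<Rightarrow> 'a set \<Rightarrow> nat" where
  "point_count G A = size (filter_mset (\<lambda>x. x \<in> A) G)"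

definition poisson_process ::
  "'w measure \<Rightarrow> 'a::euclidean_space set \<Rightarrow> ('a \<Rightarrow> real) \<Rightarrow> ('w \<Rightarrow> 'a multiset) \<Rightarrow> bool" where
  "poisson_process P M h G \<longleftrightarrow>
     integrable (lebesgue_on M) h \<and> (AE x in lebesgue_on M. 0 \<le> h x) \<and>
     (\<forall>\<omega>\<in>space P. set_mset (G \<omega>) \<subseteq> M) \<and>
     (\<forall>A\<in>sets borel. A \<subseteq> M \<longrightarrow>
        has_bochner_integral P (\<lambda>\<omega>. real (point_count (G \<omega>) A)) (\<integral>x. h x \<partial>lebesgue_on A)) \<and>
     (\<forall>(n::nat) A. (\<forall>i<n. A i \<in> sets borel \<and> A i \<subseteq> M) \<and> disjoint_family_on A {..<n} \<longrightarrow>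
        prob_space.indep_vars P (\<lambda>_. borel) (\<lambda>i \<omega>. real (point_count (G \<omega>) (A i))) {..<n})"

text \<open>
  In the following definitions \<open>G\<close> is the unscaled point configuration; the measure
  under consideration is \<open>G\<close> divided by \<open>t\<close>.
\<close>

definition scaled_integral :: "real \<Rightarrow> 'a multiset \<Rightarrow> ('a \<Rightarrow> real) \<Rightarrow> real" where
  "scaled_integral t G \<psi> = (1 / t) * (\<Sum>x\<in>#G. \<psi> x)"

definition data_fidelity ::
  "'a::euclidean_space set \<Rightarrow> real \<Rightarrow> real \<Rightarrow> 'a multiset \<Rightarrow> ('a \<Rightarrow> real) \<Rightarrow> real" where
  "data_fidelity M \<sigma> t G g =
     (\<integral>x. g x \<partial>lebesgue_on M) -
     (scaled_integral t G (\<lambda>x. ln (g x + \<sigma>)) + (\<integral>x. ln (g x + \<sigma>) * \<sigma> \<partial>lebesgue_on M))"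

definition exact_fidelity ::
  "'a::euclidean_space set \<Rightarrow> real \<Rightarrow> ('a \<Rightarrow> real) \<Rightarrow> ('a \<Rightarrow> real) \<Rightarrow> real" where
  "exact_fidelity M \<sigma> g0 g =
     (\<integral>x. g x - g0 x - (g0 x + \<sigma>) * ln ((g x + \<sigma>) / (g0 x + \<sigma>)) \<partial>lebesgue_on M)"

definition data_noise ::
  "'a::euclidean_space set \<Rightarrow> real \<Rightarrow> ('a \<Rightarrow> real) \<Rightarrow> real \<Rightarrow> 'a multiset \<Rightarrow> ('a \<Rightarrow> real) \<Rightarrow> real"
where
  "data_noise M \<sigma> g0 t G g =
     \<bar>scaled_integral t G (\<lambda>x. ln (g x + \<sigma>)) - (\<integral>x. ln (g x + \<sigma>) * g0 x \<partial>lebesgue_on M)\<bar>"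

definition concentration_scale :: "real \<Rightarrow> real \<Rightarrow> real \<Rightarrow> real \<Rightarrow> real" where
  "concentration_scale R \<sigma> s C = R * max (\<sigma> powi (- \<lfloor>s\<rfloor> - 1)) \<bar>ln R\<bar> * C"


section \<open>Convex functionals with values in the extended reals\<close>

definition proper_convex :: "('x::real_vector \<Rightarrow> ereal) \<Rightarrow> bool" where
  "proper_convex J \<longleftrightarrow>
     (\<forall>u. J u \<noteq> - \<infinity>) \<and> (\<exists>u. J u \<noteq> \<infinity>) \<and>
     (\<forall>u v. \<forall>l\<in>{0<..<1}. J ((1 - l) *\<^sub>R u + l *\<^sub>R v) \<le> ereal (1 - l) * J u + ereal l * J v)"

definition subdifferential ::
  "('x::real_normed_vector \<Rightarrow> ereal) \<Rightarrow> 'x \<Rightarrow> ('x \<Rightarrow>\<^sub>L real) set" where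
  "subdifferential J u0 =
     {p. J u0 < \<infinity> \<and> (\<forall>u. J u0 + ereal (blinfun_apply p (u - u0)) \<le> J u)}"

definition bregman_distance ::
  "('x::real_normed_vector \<Rightarrow> ereal) \<Rightarrow> ('x \<Rightarrow>\<^sub>L real) \<Rightarrow> 'x \<Rightarrow> 'x \<Rightarrow> ereal" where
  "bregman_distance J p u u0 = J u - J u0 - ereal (blinfun_apply p (u - u0))"

text \<open>Only the values on \<open>{0..}\<close> of an index function are relevant.\<close>

definition index_function :: "(real \<Rightarrow> real) \<Rightarrow> bool" where
  "index_function \<phi> \<longleftrightarrow>
     (\<forall>x\<ge>0. 0 \<le> \<phi> x) \<and> mono_on {0..} \<phi> \<and> \<phi> 0 = 0 \<and> (\<exists>x\<ge>0. \<phi> x \<noteq> 0)"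


section \<open>The balancing principle\<close>

text \<open>The index \<open>j\<close> ranges over the positive integers.\<close>

definition reg_param :: "real \<Rightarrow> real \<Rightarrow> real \<Rightarrow> nat \<Rightarrow> real" where
  "reg_param \<tau> r t j = \<tau> * ln t / sqrt t * r ^ (2 * j - 2)"

definition max_index :: "real \<Rightarrow> real \<Rightarrow> real \<Rightarrow> nat" where
  "max_index \<tau> r t = (LEAST j. 1 \<le> j \<and> 1 \<le> reg_param \<tau> r t j)"

definition balancing_index ::
  "real \<Rightarrow> real \<Rightarrow> real \<Rightarrow> nat \<Rightarrow> (nat \<Rightarrow> 'x::real_normed_vector) \<Rightarrow> nat" where
  "balancing_index C q r m v =
     Max {j \<in> {1..m}. \<forall>i\<in>{1..<j}.
            norm (v i - v j) \<le> 4 * (4 * C) powr (1 / q) * r powr ((2 - 2 * real i) / q)}"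

end

theory Submission
  imports Defs "HOL-Real_Asymp.Real_Asymp"
begin

text \<open>
  Let \<open>\<delta> = ln t / sqrt t\<close>. The minimizing property, the source condition and \<open>\<beta> \<ge> 1 / 2\<close> give
  \<open>\<parallel>u\<^sub>\<alpha> - u0\<parallel> powr q \<le> 2 * Cbd * (N / \<alpha> + (\<phi> T - T / \<alpha>))\<close>, where \<open>N\<close> is twice the supremum of the data
  noise and \<open>T \<ge> 0\<close> the exact fidelity. Outside an event of probability at most \<open>t powr (- 1 / 4)\<close>,
  concentration with \<open>\<rho> = \<tau> * ln t\<close> yields \<open>N \<le> 2 * \<tau> * \<delta>\<close>. Concavity of \<open>\<phi>\<^sup>2\<close> makes \<open>\<phi> x / x\<close> decreasing, so
  that \<open>\<phi> T - T / \<alpha>\<close> is of order \<open>\<phi> \<delta>\<close> for \<open>\<alpha>\<close> of order \<open>\<delta> / \<phi> \<delta>\<close>; for some index \<open>j\<close> on the grid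
  both contributions therefore balance, and the Lepskii argument shows that the balancing index
  costs only a constant factor over \<open>j\<close>. On the exceptional event the error is bounded because \<open>B\<close>
  is, and concavity of \<open>\<phi>\<^sup>2\<close> also gives \<open>\<phi> \<delta> \<ge> c * sqrt \<delta> \<ge> c * t powr (- 1 / 4)\<close>.
\<close>

subsection \<open>Index functions\<close>

text \<open>Concavity is applied to the chord from \<open>0\<close> to \<open>y\<close>, with
  \<open>\<phi> 0 = 0\<close>: the quotient \<open>(\<phi> x)^2 / x\<close> is nonincreasing. All
  growth estimates for \<open>\<phi>\<close> rest on this.\<close>

lemma index_function_scaling:
  assumes "index_function \<phi>" "concave_on {0..} (\<lambda>x. (\<phi> x)\<^sup>2)" "0 < x" "x \<le> y"
  shows "x / y * (\<phi> y)\<^sup>2 \<le> (\<phi> x)\<^sup>2"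
proof -
  have c: "convex_on {0..} (\<lambda>x. - (\<phi> x)\<^sup>2)"
    using assms(2) by (simp add: concave_on_def)
  have "- (\<phi> ((1 - x / y) *\<^sub>R 0 + (x / y) *\<^sub>R y))\<^sup>2
      \<le> (1 - x / y) * - (\<phi> 0)\<^sup>2 + x / y * - (\<phi> y)\<^sup>2"
    by (rule convex_onD[OF c]) (use assms in auto)
  thus ?thesis
    using assms by (simp add: index_function_def)
qed

text \<open>Scaling gives the factor \<open>sqrt (y / x)\<close>; as \<open>y / x \<ge> 1\<close>,
  the weaker linear factor follows, which is the form that compares \<open>\<phi> T\<close> with a
  multiple of \<open>T\<close>.\<close>

lemma index_function_linear_bound:
  assumes "index_function \<phi>" "concave_on {0..} (\<lambda>x. (\<phi> x)\<^sup>2)" "0 < x" "x \<le> y"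
  shows "\<phi> y \<le> y / x * \<phi> x"
proof (rule power2_le_imp_le)
  have pos: "0 < y" "0 \<le> \<phi> x" using assms by (auto simp: index_function_def)
  have "(\<phi> y)\<^sup>2 \<le> y / x * (\<phi> x)\<^sup>2"
    using index_function_scaling[OF assms] pos assms(3) by (simp add: field_simps)
  also have "\<dots> \<le> (y / x)\<^sup>2 * (\<phi> x)\<^sup>2"
    using self_le_power[of "y / x" 2] pos assms(3,4) by (intro mult_right_mono) auto
  finally show "(\<phi> y)\<^sup>2 \<le> (y / x * \<phi> x)\<^sup>2"
    by (simp add: power_mult_distrib power_divide)
  show "0 \<le> y / x * \<phi> x" using pos assms(3) by simp
qed

text \<open>Comparison with a point \<open>y\<close> where \<open>\<phi>\<close> does not vanish:
  near \<open>0\<close> an index function of this kind decays no faster than a square root.\<close>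

lemma index_function_sqrt_lower_bound:
  assumes "index_function \<phi>" "concave_on {0..} (\<lambda>x. (\<phi> x)\<^sup>2)"
  obtains c y where "0 < c" "0 < y" "\<And>x. 0 < x \<Longrightarrow> x \<le> y \<Longrightarrow> c * sqrt x \<le> \<phi> x"
proof -
  obtain y where y: "0 \<le> y" "\<phi> y \<noteq> 0" using assms(1) by (auto simp: index_function_def)
  have pos: "0 < y" "0 < \<phi> y"
    using y assms(1) by (metis index_function_def less_eq_real_def)+
  show thesis
  proof (rule that[of "\<phi> y / sqrt y" y])
    fix x assume x: "0 < x" "x \<le> y"
    have "(\<phi> y / sqrt y * sqrt x)\<^sup>2 = x / y * (\<phi> y)\<^sup>2"
      using x pos by (simp add: power_mult_distrib power_divide)
    also have "\<dots> \<le> (\<phi> x)\<^sup>2" using index_function_scaling[OF assms x] .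
    finally show "\<phi> y / sqrt y * sqrt x \<le> \<phi> x"
      by (rule power2_le_imp_le) (use x assms(1) in \<open>auto simp: index_function_def\<close>)
  qed (use pos in auto)
qed

text \<open>This stands in for a bound on the convex conjugate of \<open>- \<phi>\<close>. Up to
  \<open>\<delta>\<close>, monotonicity and the hypothesis with \<open>c\<close> suffice. Beyond
  \<open>\<delta>\<close>, the other hypothesis makes the slope
  \<open>\<phi> \<delta> / \<delta>\<close> at most \<open>1 / \<alpha>\<close>, so the difference
  is not positive.\<close>

lemma index_function_conjugate_bound:
  assumes "index_function \<phi>" "concave_on {0..} (\<lambda>x. (\<phi> x)\<^sup>2)"
    and "0 < \<delta>" "0 < \<alpha>" "\<alpha> * \<phi> \<delta> \<le> \<delta>" "\<alpha> * \<phi> \<delta> \<le> c * \<delta>" "0 \<le> T"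
  shows "\<phi> T - T / \<alpha> \<le> c * \<delta> / \<alpha>"
proof (cases "T \<le> \<delta>")
  case True
  hence "\<phi> T \<le> \<phi> \<delta>"
    using assms(1,3,7) mono_onD[of "{0..}" \<phi> T \<delta>] by (simp add: index_function_def)
  also have "\<dots> \<le> c * \<delta> / \<alpha>" using assms(4,6) by (simp add: field_simps)
  finally show ?thesis using divide_nonneg_pos[OF assms(7,4)] by linarith
next
  case False
  have "0 \<le> \<phi> \<delta>" using assms(1,3) by (simp add: index_function_def)
  hence nn: "0 \<le> c * \<delta>" using assms(4,6) mult_nonneg_nonneg[of \<alpha> "\<phi> \<delta>"] by linarith
  have "\<phi> T \<le> T / \<delta> * \<phi> \<delta>"
    using index_function_linear_bound[OF assms(1-3), of T] False by simp
  also have "\<dots> \<le> T / \<delta> * (\<delta> / \<alpha>)"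
    using assms(3-5,7) by (intro mult_left_mono) (auto simp: pos_le_divide_eq mult.commute)
  also have "\<dots> = T / \<alpha>" using assms(3) by simp
  finally show ?thesis using divide_nonneg_pos[OF nn assms(4)] by linarith
qed

subsection \<open>Balancing\<close>

text \<open>Since \<open>\<Psi>\<close> is nonincreasing, the triangle inequality through
  \<open>u0\<close> shows that \<open>j\<close> passes the test, with \<open>4 = 2 + 2\<close>.
  Hence the selected index is at least \<open>j\<close>; having passed the test against
  \<open>j\<close> itself, it costs \<open>4 * \<Psi> j\<close> on top of the error
  \<open>2 * \<Psi> j\<close>.\<close>

lemma balancing_index_error:
  fixes v :: "nat \<Rightarrow> 'x::real_normed_vector" and C q r :: real
  defines "\<Psi> \<equiv> \<lambda>i. (4 * C) powr (1 / q) * r powr ((2 - 2 * real i) / q)"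
  assumes r: "1 \<le> r" and q: "1 \<le> q" and j: "j \<in> {1..m}"
    and err: "\<And>i. i \<in> {1..j} \<Longrightarrow> norm (v i - u0) \<le> 2 * \<Psi> i"
  shows "norm (v (balancing_index C q r m v) - u0) \<le> 6 * \<Psi> j"
proof -
  let ?A = "{j \<in> {1..m}. \<forall>i\<in>{1..<j}. norm (v i - v j) \<le> 4 * \<Psi> i}"
  define b where "b = balancing_index C q r m v"
  have b_Max: "b = Max ?A"
    unfolding b_def balancing_index_def \<Psi>_def by (simp add: mult.assoc)
  have "norm (v i - v j) \<le> 4 * \<Psi> i" if "i \<in> {1..<j}" for i
  proof -
    have "\<Psi> j \<le> \<Psi> i"
      unfolding \<Psi>_def using that r q by (intro mult_left_mono powr_mono divide_right_mono) auto
    moreover have "norm (v i - v j) \<le> norm (v i - u0) + norm (v j - u0)"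
      using norm_triangle_ineq4[of "v i - u0" "v j - u0"] by simp
    ultimately show ?thesis using err[of i] err[of j] that j by simp
  qed
  hence jA: "j \<in> ?A" using j by auto
  have bA: "b \<in> ?A" unfolding b_Max by (rule Max_in) (use jA in auto)
  have jb: "j \<le> b" unfolding b_Max by (rule Max_ge) (use jA in auto)
  have "norm (v j - v b) \<le> 4 * \<Psi> j"
  proof (cases "j = b")
    case True thus ?thesis by (simp add: \<Psi>_def)
  next
    case False thus ?thesis using bA jb j by auto
  qed
  moreover have "norm (v b - u0) \<le> norm (v j - v b) + norm (v j - u0)"
    using norm_triangle_ineq4[of "v j - u0" "v j - v b"] by simp
  ultimately show "norm (v (balancing_index C q r m v) - u0) \<le> 6 * \<Psi> j"
    using err[of j] j by (simp add: b_def)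
qed

section \<open>The geometric grid of regularization parameters\<close>

lemma reg_param_bracket:
  assumes "0 < \<tau>" "1 < r" "1 < t" "reg_param \<tau> r t 1 \<le> A"
  obtains j where "1 \<le> j" "reg_param \<tau> r t j \<le> A" "A < r\<^sup>2 * reg_param \<tau> r t j"
proof -
  define a where "a = \<tau> * ln t / sqrt t"
  have a: "0 < a" using assms by (simp add: a_def)
  have param: "reg_param \<tau> r t (Suc k) = a * (r\<^sup>2) ^ k" for k
    by (simp add: reg_param_def a_def power_mult[symmetric])
  have "1 < r\<^sup>2" using assms(2) by (simp add: one_less_power)
  then obtain n where "A / a < (r\<^sup>2) ^ n" using real_arch_pow by blast
  hence ex: "A < a * (r\<^sup>2) ^ n" using a by (simp add: field_simps)
  \<comment> \<open>The predecessor of the first grid point beyond \<open>A\<close> is the last one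
    not exceeding \<open>A\<close>, and consecutive points differ by the factor
    \<open>r^2\<close>.\<close>
  define k where "k = (LEAST k. A < a * (r\<^sup>2) ^ k)"
  have k: "A < a * (r\<^sup>2) ^ k" unfolding k_def by (rule LeastI[of _ n]) (rule ex)
  have "k \<noteq> 0" using k assms(4) param[of 0] by (intro notI) simp
  then obtain l where l: "k = Suc l" using not0_implies_Suc by blast
  have "\<not> A < a * (r\<^sup>2) ^ l" by (rule not_less_Least) (simp add: k_def[symmetric] l)
  thus thesis using that[of "Suc l"] k by (simp add: param l mult_ac)
qed

lemma reg_param_mono:
  assumes "0 < \<tau>" "1 < r" "1 < t" "i \<le> j"
  shows "reg_param \<tau> r t i \<le> reg_param \<tau> r t j"
  unfolding reg_param_def using assms by (intro mult_left_mono power_increasing) auto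

lemma reg_param_pos: "0 < \<tau> \<Longrightarrow> 1 < r \<Longrightarrow> 1 < t \<Longrightarrow> 0 < reg_param \<tau> r t j"
  by (simp add: reg_param_def)

text \<open>The parameter at \<open>max_index\<close> is at least \<open>1\<close> and parameters
  increase with the index, so an index with a smaller parameter cannot come later.\<close>

lemma le_max_index:
  assumes "0 < \<tau>" "1 < r" "1 < t" "1 \<le> j" "reg_param \<tau> r t j < 1"
  shows "j \<le> max_index \<tau> r t"
proof -
  \<comment> \<open>The \<open>LEAST\<close> is meaningful only if some parameter reaches
    \<open>1\<close>. Bracketing a level that is at least \<open>1\<close> and at least the first
    parameter shows that index \<open>Suc k\<close> does so.\<close>
  obtain k where k: "1 \<le> k" "1 < r\<^sup>2 * reg_param \<tau> r t k"
    using reg_param_bracket[OF assms(1-3), of "max 1 (reg_param \<tau> r t 1)"] by auto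
  have "reg_param \<tau> r t (Suc k) = r\<^sup>2 * reg_param \<tau> r t k"
    using k(1) by (cases k) (simp_all add: reg_param_def power2_eq_square)
  hence "1 \<le> Suc k \<and> 1 \<le> reg_param \<tau> r t (Suc k)" using k by simp
  hence "1 \<le> reg_param \<tau> r t (max_index \<tau> r t)"
    unfolding max_index_def by (rule LeastI2) simp
  thus ?thesis
    using reg_param_mono[OF assms(1-3), of "max_index \<tau> r t" j] assms(5) by linarith
qed

subsection \<open>Variational estimate\<close>

text \<open>The integrand is of Kullback-Leibler type; \<open>ln z \<le> z - 1\<close> at the ratio
  of the shifted densities gives its sign pointwise.\<close>

lemma exact_fidelity_nonneg:
  assumes "0 < \<sigma>" "\<And>x. x \<in> M \<Longrightarrow> 0 \<le> g0 x" "\<And>x. x \<in> M \<Longrightarrow> 0 \<le> g x"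
  shows "0 \<le> exact_fidelity M \<sigma> g0 g"
  unfolding exact_fidelity_def
proof (rule Bochner_Integration.integral_nonneg)
  fix x assume "x \<in> space (lebesgue_on M)"
  hence g: "0 \<le> g0 x" "0 \<le> g x" using assms by auto
  have "(g0 x + \<sigma>) * ln ((g x + \<sigma>) / (g0 x + \<sigma>)) \<le> (g0 x + \<sigma>) * ((g x + \<sigma>) / (g0 x + \<sigma>) - 1)"
    using g \<open>0 < \<sigma>\<close> by (intro mult_left_mono ln_le_minus_one) auto
  also have "\<dots> = g x - g0 x" using g \<open>0 < \<sigma>\<close> by (simp add: field_simps)
  finally show "0 \<le> g x - g0 x - (g0 x + \<sigma>) * ln ((g x + \<sigma>) / (g0 x + \<sigma>))" by simp
qed

text \<open>Replacing the scaled point measure by \<open>g0 dx\<close> turns the difference of the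
  data fidelities into \<open>exact_fidelity\<close>; the replacement costs the noise once at
  \<open>g\<close> and once at \<open>g0\<close>. The integrability assumptions justify splitting
  the integral.\<close>

lemma exact_fidelity_le:
  assumes "0 < \<sigma>" "\<And>x. x \<in> M \<Longrightarrow> 0 \<le> g0 x" "\<And>x. x \<in> M \<Longrightarrow> 0 \<le> g x"
    and [simp]: "integrable (lebesgue_on M) g" "integrable (lebesgue_on M) g0"
      "integrable (lebesgue_on M) (\<lambda>x. ln (g x + \<sigma>))"
      "integrable (lebesgue_on M) (\<lambda>x. ln (g0 x + \<sigma>))"
      "integrable (lebesgue_on M) (\<lambda>x. ln (g x + \<sigma>) * g0 x)"
      "integrable (lebesgue_on M) (\<lambda>x. ln (g0 x + \<sigma>) * g0 x)"
  shows "exact_fidelity M \<sigma> g0 g \<le> data_fidelity M \<sigma> t G g - data_fidelity M \<sigma> t G g0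
    + data_noise M \<sigma> g0 t G g + data_noise M \<sigma> g0 t G g0"
proof -
  have "exact_fidelity M \<sigma> g0 g = (\<integral>x. g x - g0 x - ln (g x + \<sigma>) * g0 x - ln (g x + \<sigma>) * \<sigma>
      + ln (g0 x + \<sigma>) * g0 x + ln (g0 x + \<sigma>) * \<sigma> \<partial>lebesgue_on M)"
    unfolding exact_fidelity_def
  proof (rule Bochner_Integration.integral_cong)
    fix x assume "x \<in> space (lebesgue_on M)"
    hence "0 < g0 x + \<sigma>" "0 < g x + \<sigma>" using assms by (auto intro: add_nonneg_pos)
    thus "g x - g0 x - (g0 x + \<sigma>) * ln ((g x + \<sigma>) / (g0 x + \<sigma>)) =
      g x - g0 x - ln (g x + \<sigma>) * g0 x - ln (g x + \<sigma>) * \<sigma>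
      + ln (g0 x + \<sigma>) * g0 x + ln (g0 x + \<sigma>) * \<sigma>"
      by (simp add: ln_div algebra_simps)
  qed simp
  also have "\<dots> = (\<integral>x. g x \<partial>lebesgue_on M) - (\<integral>x. g0 x \<partial>lebesgue_on M)
      - (\<integral>x. ln (g x + \<sigma>) * g0 x \<partial>lebesgue_on M) - (\<integral>x. ln (g x + \<sigma>) * \<sigma> \<partial>lebesgue_on M)
      + (\<integral>x. ln (g0 x + \<sigma>) * g0 x \<partial>lebesgue_on M) + (\<integral>x. ln (g0 x + \<sigma>) * \<sigma> \<partial>lebesgue_on M)"
    by simp
  finally show ?thesis
    unfolding data_fidelity_def data_noise_def by linarith
qed

text \<open>Comparing the objective at \<open>v\<close> and at \<open>u0\<close> gives
  \<open>J v - J u0 \<le> (N - T) / \<alpha>\<close>. The source condition adds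
  \<open>\<phi> T\<close>, and \<open>- T / \<alpha>\<close> is kept to compensate it.\<close>

lemma minimizer_error_bound:
  assumes "proper_convex J" "ustar \<in> subdifferential J u0" "1 / 2 \<le> \<beta>" "0 < \<alpha>"
    and min: "ereal S + ereal \<alpha> * J v \<le> ereal S0 + ereal \<alpha> * J u0"
    and source: "ereal \<beta> * bregman_distance J ustar v u0 \<le> J v - J u0 + ereal (\<phi> T)"
    and norm: "ereal (norm (v - u0) powr q) \<le> ereal C * bregman_distance J ustar v u0"
    and "0 < C" and T: "T \<le> S - S0 + N"
  shows "norm (v - u0) powr q \<le> 2 * C * (N / \<alpha> + (\<phi> T - T / \<alpha>))"
proof -
  have notMinf: "J x \<noteq> - \<infinity>" for x using assms(1) by (simp add: proper_convex_def)
  have "J u0 < \<infinity>" using assms(2) by (simp add: subdifferential_def)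
  then obtain b where b: "J u0 = ereal b" using notMinf[of u0] by (cases "J u0") auto
  \<comment> \<open>\<open>J v\<close> is finite because the objective at \<open>v\<close> is at
    most its finite value at \<open>u0\<close>.\<close>
  obtain a where a: "J v = ereal a"
    using min notMinf[of v] \<open>0 < \<alpha>\<close> b by (cases "J v") auto
  define D where "D = a - b - blinfun_apply ustar (v - u0)"
  have D: "bregman_distance J ustar v u0 = ereal D"
    by (simp add: bregman_distance_def a b D_def)
  have nD: "norm (v - u0) powr q \<le> C * D" using norm D by simp
  \<comment> \<open>The sign of \<open>D\<close> is what allows \<open>\<beta>\<close> to be lowered
    to \<open>1 / 2\<close>.\<close>
  have "0 \<le> D"
    using nD \<open>0 < C\<close> powr_ge_zero[of "norm (v - u0)" q] by (smt (verit) mult_pos_neg)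
  hence 1: "D / 2 \<le> \<beta> * D" using mult_right_mono[OF assms(3), of D] by simp
  have 2: "\<beta> * D \<le> a - b + \<phi> T" using source a b D by simp
  define X where "X = (N - T) / \<alpha>"
  have 3: "a - b \<le> X"
    using min a b T \<open>0 < \<alpha>\<close> by (simp add: X_def field_simps)
  have "D / 2 \<le> X + \<phi> T" using order_trans[OF 1 order_trans[OF 2 add_right_mono[OF 3]]] .
  hence "D \<le> 2 * (X + \<phi> T)" by simp
  also have "X + \<phi> T = N / \<alpha> + (\<phi> T - T / \<alpha>)" by (simp add: X_def diff_divide_distrib)
  finally have "D \<le> 2 * (N / \<alpha> + (\<phi> T - T / \<alpha>))" .
  hence "C * D \<le> C * (2 * (N / \<alpha> + (\<phi> T - T / \<alpha>)))"
    by (rule mult_left_mono) (use \<open>0 < C\<close> in simp)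
  thus ?thesis using order_trans[OF nD] by (simp only: mult_ac)
qed

subsection \<open>Poisson processes\<close>

lemma borel_measurable_indicator_times_continuous:
  fixes f :: "'a::euclidean_space \<Rightarrow> real"
  assumes "open M" "continuous_on M f"
  shows "(\<lambda>x. indicator M x * f x) \<in> borel_measurable borel"
proof -
  have "(\<lambda>x. indicat_real M x *\<^sub>R f x) \<in> borel_measurable borel"
    by (rule borel_measurable_continuous_on_indicator) (use assms in auto)
  thus ?thesis by simp
qed

text \<open>The set where \<open>f\<close> is negative is open and null, hence empty. The sign is
  wanted at every point because \<open>ln (F v + \<sigma>)\<close> is evaluated at the atoms of the
  process.\<close>

lemma continuous_on_AE_nonneg_imp_nonneg:
  fixes f :: "'a::euclidean_space \<Rightarrow> real"
  assumes "open M" "continuous_on M f" "AE x in lebesgue_on M. 0 \<le> f x" "x \<in> M"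
  shows "0 \<le> f x"
proof -
  let ?U = "{x \<in> M. f x < 0}"
  have "?U = M \<inter> f -` {..<0}" by auto
  hence op: "open ?U"
    using continuous_open_preimage[OF assms(2,1), of "{..<0}"] by auto
  have "AE x in lebesgue. x \<in> M \<longrightarrow> 0 \<le> f x"
    using assms by (subst (asm) AE_restrict_space_iff) auto
  hence "AE x in lebesgue. x \<notin> ?U" by eventually_elim auto
  hence "?U \<in> null_sets lebesgue"
    using op by (subst AE_iff_null_sets) auto
  hence "negligible ?U" by (simp add: negligible_iff_null_sets)
  hence "?U = {}" using open_not_negligible[OF op] by auto
  thus ?thesis using assms(4) by fastforce
qed

section \<open>Means of sums over the points of a Poisson process\<close>

lemma sum_mset_SUP_ennreal:
  fixes U :: "nat \<Rightarrow> 'a \<Rightarrow> ennreal"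
  assumes "incseq U"
  shows "(\<Sum>x\<in>#G. SUP i. U i x) = (SUP i. \<Sum>x\<in>#G. U i x)"
proof (induction G)
  case (add y G)
  have "incseq (\<lambda>i. U i y)" using assms by (auto simp: incseq_def le_fun_def)
  moreover have "incseq (\<lambda>i. \<Sum>x\<in>#G. U i x)"
    using assms by (auto simp: incseq_def le_fun_def intro!: sum_mset_mono)
  ultimately show ?case using add by (simp add: ennreal_SUP_add)
qed simp

lemma sum_mset_nonneg:
  fixes f :: "'a \<Rightarrow> 'b::ordered_comm_monoid_add"
  assumes "\<And>x. 0 \<le> f x"
  shows "0 \<le> (\<Sum>x\<in>#G. f x)"
  by (induction G) (auto simp: assms intro: add_nonneg_nonneg)

lemma sum_mset_ennreal:
  assumes "\<And>x. 0 \<le> f x"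
  shows "(\<Sum>x\<in>#G. ennreal (f x)) = ennreal (\<Sum>x\<in>#G. f x)"
proof (induction G)
  case (add x G)
  have "0 \<le> (\<Sum>x\<in>#G. f x)" by (rule sum_mset_nonneg[OF assms])
  thus ?case using add assms[of x] by simp
qed simp

lemma sum_mset_indicator: "(\<Sum>x\<in>#G. indicator A x :: ennreal) = of_nat (point_count G A)"
  by (induction G) (auto simp: point_count_def add.commute)

text \<open>Campbell's formula: the mean count in \<open>poisson_process\<close> is the case of an
  indicator, and sums, multiples and monotone limits extend it. Measurability in
  \<open>\<omega>\<close> is carried through the induction because additivity and monotone
  convergence of the integral over \<open>P\<close> require it.\<close>

lemma poisson_process_Campbell:
  fixes M :: "'a::euclidean_space set"
  assumes pp: "poisson_process P M h G" and M: "open M" and f: "f \<in> borel_measurable borel"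
  shows "(\<lambda>\<omega>. \<Sum>x\<in>#G \<omega>. f x) \<in> borel_measurable P \<and>
    (\<integral>\<^sup>+\<omega>. (\<Sum>x\<in>#G \<omega>. f x) \<partial>P) = (\<integral>\<^sup>+x. f x * ennreal (h x) \<partial>lebesgue_on M)"
proof -
  let ?N = "lebesgue_on M"
  have hint: "integrable ?N h" and hpos: "AE x in ?N. 0 \<le> h x"
    and sub: "\<And>\<omega>. \<omega> \<in> space P \<Longrightarrow> set_mset (G \<omega>) \<subseteq> M"
    using pp by (auto simp: poisson_process_def)
  have M_leb: "M \<in> sets lebesgue" using M by simp
  have hN[measurable]: "h \<in> borel_measurable ?N" using hint by auto
  have meas_h: "(\<lambda>x. g x * ennreal (h x)) \<in> borel_measurable ?N"
    if "g \<in> borel_measurable borel" for g :: "'a \<Rightarrow> ennreal"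
  proof -
    have [measurable]: "g \<in> borel_measurable ?N"
      using that by (intro measurable_restrict_space1 measurable_completion) simp
    show ?thesis by measurable
  qed
  show ?thesis using f
  proof (induction f rule: borel_measurable_induct)
    case (cong f g)
    hence "f = g" by auto
    thus ?case using cong by simp
  next
    case (set A)
    \<comment> \<open>Mean counts are given only for Borel subsets of \<open>M\<close>; since all
      atoms lie in \<open>M\<close>, intersecting with \<open>M\<close> leaves the sum
      unchanged.\<close>
    define A' where "A' = A \<inter> M"
    have A': "A' \<in> sets borel" "A' \<subseteq> M" "A' \<in> sets ?N"
      using set M by (auto simp: A'_def sets_restrict_space)
    have eq: "(\<Sum>x\<in>#G \<omega>. indicator A x) = ennreal (real (point_count (G \<omega>) A'))"
      if "\<omega> \<in> space P" for \<omega>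
    proof -
      have "filter_mset (\<lambda>x. x \<in> A) (G \<omega>) = filter_mset (\<lambda>x. x \<in> A') (G \<omega>)"
        using sub[OF that] by (intro filter_mset_cong) (auto simp: A'_def)
      thus ?thesis by (simp add: sum_mset_indicator point_count_def ennreal_of_nat_eq_real_of_nat)
    qed
    have "has_bochner_integral P (\<lambda>\<omega>. real (point_count (G \<omega>) A')) (\<integral>x. h x \<partial>lebesgue_on A')"
      using pp A' by (auto simp: poisson_process_def)
    hence bi: "integrable P (\<lambda>\<omega>. real (point_count (G \<omega>) A'))"
        "(\<integral>\<omega>. real (point_count (G \<omega>) A') \<partial>P) = (\<integral>x. h x \<partial>lebesgue_on A')"
      by (auto simp: has_bochner_integral_iff)
    have "(\<lambda>\<omega>. ennreal (real (point_count (G \<omega>) A'))) \<in> borel_measurable P"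
      by (intro measurable_compose[OF borel_measurable_integrable[OF bi(1)]]) simp
    hence meas: "(\<lambda>\<omega>. \<Sum>x\<in>#G \<omega>. indicator A x :: ennreal) \<in> borel_measurable P"
      by (rule measurable_cong[THEN iffD2, rotated]) (rule eq)
    have "(\<integral>\<^sup>+\<omega>. (\<Sum>x\<in>#G \<omega>. indicator A x) \<partial>P) = (\<integral>\<^sup>+\<omega>. ennreal (real (point_count (G \<omega>) A')) \<partial>P)"
      by (intro nn_integral_cong eq)
    also have "\<dots> = ennreal (\<integral>x. h x \<partial>lebesgue_on A')"
      using bi by (subst nn_integral_eq_integral) auto
    also have "lebesgue_on A' = restrict_space ?N A'"
      using A'(2) by (simp add: restrict_restrict_space M_leb set Int_absorb1 A'(1))
    also have "(\<integral>x. h x \<partial>restrict_space ?N A') = (\<integral>x. indicator A' x * h x \<partial>?N)"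
      using A' by (subst integral_restrict_space) (auto simp: Int_absorb2)
    also have "ennreal \<dots> = (\<integral>\<^sup>+x. ennreal (indicator A' x * h x) \<partial>?N)"
    proof (rule nn_integral_eq_integral[symmetric])
      show "integrable ?N (\<lambda>x. indicator A' x * h x)"
        using integrable_mult_indicator[OF A'(3) hint] by simp
      show "AE x in ?N. 0 \<le> indicator A' x * h x" using hpos by eventually_elim simp
    qed
    also have "\<dots> = (\<integral>\<^sup>+x. indicator A x * ennreal (h x) \<partial>?N)"
      by (intro nn_integral_cong) (auto simp: A'_def indicator_def)
    finally show ?case using meas by blast
  next
    case (mult u c)
    have "(\<lambda>x. u x * ennreal (h x)) \<in> borel_measurable ?N" by (rule meas_h[OF mult(2)])
    moreover have "(\<Sum>x\<in>#G \<omega>. c * u x) = c * (\<Sum>x\<in>#G \<omega>. u x)" for \<omega>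
      by (simp add: sum_mset_distrib_left)
    moreover have [measurable]: "(\<lambda>\<omega>. \<Sum>x\<in>#G \<omega>. u x) \<in> borel_measurable P" using mult.IH by blast
    have "(\<lambda>\<omega>. c * (\<Sum>x\<in>#G \<omega>. u x)) \<in> borel_measurable P" by measurable
    ultimately show ?case
      using mult.IH by (simp only: mult.assoc) (simp add: nn_integral_cmult)
  next
    case (add u v)
    have "(\<lambda>x. u x * ennreal (h x)) \<in> borel_measurable ?N"
        "(\<lambda>x. v x * ennreal (h x)) \<in> borel_measurable ?N"
      by (rule meas_h, fact add)+
    hence "(\<integral>\<^sup>+x. (v x + u x) * ennreal (h x) \<partial>?N) =
        (\<integral>\<^sup>+x. v x * ennreal (h x) \<partial>?N) + (\<integral>\<^sup>+x. u x * ennreal (h x) \<partial>?N)"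
      unfolding distrib_right by (intro nn_integral_add)
    moreover have "(\<lambda>\<omega>. \<Sum>x\<in>#G \<omega>. u x) \<in> borel_measurable P"
        "(\<lambda>\<omega>. \<Sum>x\<in>#G \<omega>. v x) \<in> borel_measurable P"
      using add.IH by blast+
    ultimately show ?case
      using add.IH unfolding sum_mset.distrib
      by (intro conjI) (auto simp only: nn_integral_add intro: borel_measurable_add)
  next
    case (seq U)
    have inc: "incseq (\<lambda>i \<omega>. \<Sum>x\<in>#G \<omega>. U i x)" "incseq (\<lambda>i x. U i x * ennreal (h x))"
      using \<open>incseq U\<close> by (auto simp: incseq_def le_fun_def intro!: sum_mset_mono mult_right_mono)
    have meas: "(\<lambda>x. U i x * ennreal (h x)) \<in> borel_measurable ?N" for i
      by (rule meas_h) (fact seq)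
    have eq: "(\<Sum>x\<in>#G \<omega>. (SUP i. U i) x) = (SUP i. \<Sum>x\<in>#G \<omega>. U i x)" for \<omega>
      using sum_mset_SUP_ennreal[OF \<open>incseq U\<close>] by (simp add: image_image)
    have "(\<integral>\<^sup>+\<omega>. (SUP i. \<Sum>x\<in>#G \<omega>. U i x) \<partial>P) = (SUP i. \<integral>\<^sup>+\<omega>. (\<Sum>x\<in>#G \<omega>. U i x) \<partial>P)"
      using inc(1) seq.IH by (intro nn_integral_monotone_convergence_SUP) auto
    also have "\<dots> = (SUP i. \<integral>\<^sup>+x. U i x * ennreal (h x) \<partial>?N)" using seq.IH by simp
    also have "\<dots> = (\<integral>\<^sup>+x. (SUP i. U i x * ennreal (h x)) \<partial>?N)"
      using inc(2) meas by (intro nn_integral_monotone_convergence_SUP[symmetric]) auto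
    also have "\<dots> = (\<integral>\<^sup>+x. (SUP i. U i) x * ennreal (h x) \<partial>?N)"
      by (simp add: SUP_mult_right_ennreal image_image)
    finally show ?case using seq.IH unfolding eq by (intro conjI borel_measurable_SUP) auto
  qed
qed

section \<open>Integrability from exponential concentration\<close>

lemma (in prob_space) nn_integral_finite_of_exponential_tail:
  fixes W :: "'a \<Rightarrow> real"
  assumes [measurable]: "W \<in> borel_measurable M" and "0 < K"
    and tail: "\<And>\<rho>. K \<le> \<rho> \<Longrightarrow> prob {\<omega> \<in> space M. \<rho> < W \<omega>} \<le> exp (- \<rho> / K)"
  shows "(\<integral>\<^sup>+\<omega>. ennreal (W \<omega>) \<partial>M) < \<infinity>"
proof -
  let ?E = "\<lambda>n::nat. {\<omega> \<in> space M. real n < W \<omega>}"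
  \<comment> \<open>Layer-cake bound: a positive value is at most the number of naturals
    \<open>n\<close> lying strictly below it.\<close>
  have le: "ennreal (W \<omega>) \<le> (\<Sum>n. indicator (?E n) \<omega>)" if "\<omega> \<in> space M" for \<omega>
  proof -
    define N where "N = nat \<lceil>W \<omega>\<rceil>"
    have "W \<omega> \<le> real N" unfolding N_def by linarith
    hence "ennreal (W \<omega>) \<le> (\<Sum>n<N. 1)" by (simp add: ennreal_leI ennreal_of_nat_eq_real_of_nat)
    also have "\<dots> \<le> (\<Sum>n<N. indicator (?E n) \<omega>)"
      using that by (intro sum_mono) (auto simp: N_def indicator_def, linarith)
    also have "\<dots> \<le> (\<Sum>n. indicator (?E n) \<omega>)" by (rule sum_le_suminf) auto
    finally show ?thesis .
  qed
  have prob_le: "emeasure M (?E n) \<le> ennreal (exp 1 * exp (- 1 / K) ^ n)" for n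
  proof -
    have e: "exp 1 * exp (- 1 / K) ^ n = exp (1 - real n / K)"
      by (simp add: exp_of_nat_mult[symmetric] exp_add[symmetric])
    have "prob (?E n) \<le> exp (1 - real n / K)"
    proof (cases "K \<le> real n")
      case True
      have "prob (?E n) \<le> exp (- real n / K)" using tail[OF True] .
      also have "\<dots> \<le> exp (1 - real n / K)" by simp
      finally show ?thesis .
    next
      case False
      hence "1 \<le> exp (1 - real n / K)" using \<open>0 < K\<close> by simp
      thus ?thesis using prob_le_1 order_trans by blast
    qed
    thus ?thesis unfolding e emeasure_eq_measure by (rule ennreal_leI)
  qed
  have "(\<integral>\<^sup>+\<omega>. ennreal (W \<omega>) \<partial>M) \<le> (\<integral>\<^sup>+\<omega>. (\<Sum>n. indicator (?E n) \<omega>) \<partial>M)"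
    by (intro nn_integral_mono le)
  also have "\<dots> = (\<Sum>n. emeasure M (?E n))" by (subst nn_integral_suminf) auto
  also have "\<dots> \<le> (\<Sum>n. ennreal (exp 1 * exp (- 1 / K) ^ n))"
    by (intro suminf_le prob_le) auto
  also have "\<dots> < \<infinity>"
    using \<open>0 < K\<close> by (subst suminf_ennreal2) (auto intro!: summable_mult summable_geometric)
  finally show ?thesis .
qed

text \<open>The deviation bound makes the mean of the Poisson sum finite, and Campbell's formula
  identifies that mean with the integral. The constant \<open>c\<close> is arbitrary: it may be the
  very integral in question, which has the default value \<open>0\<close> in the non-integrable
  case, so no circularity arises.\<close>

lemma poisson_process_Campbell_integrable:
  fixes f :: "'a::euclidean_space \<Rightarrow> real"
  assumes P: "prob_space P" and pp: "poisson_process P M h G" and M: "open M"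
    and f: "continuous_on M f" "\<And>x. x \<in> M \<Longrightarrow> a \<le> f x" and "0 < K"
    and conc: "\<And>\<rho>. K \<le> \<rho> \<Longrightarrow> 1 - exp (- \<rho> / K) \<le> \<P>(\<omega> in P. Q \<rho> \<omega>)"
    and Q: "\<And>\<rho> \<omega>. Q \<rho> \<omega> \<Longrightarrow> \<bar>(\<Sum>x\<in>#G \<omega>. f x) - c\<bar> \<le> \<rho>"
  shows "integrable (lebesgue_on M) (\<lambda>x. f x * h x)"
proof -
  interpret prob_space P by fact
  have hint: "integrable (lebesgue_on M) h" and hpos: "AE x in lebesgue_on M. 0 \<le> h x"
    and sub: "\<And>\<omega>. \<omega> \<in> space P \<Longrightarrow> set_mset (G \<omega>) \<subseteq> M"
    using pp by (auto simp: poisson_process_def)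
  \<comment> \<open>Shifting by the lower bound \<open>a\<close> and cutting off outside
    \<open>M\<close> yields a nonnegative Borel function on the whole space; the shift is undone
    through the point count \<open>N\<close>, which has finite mean.\<close>
  define f' where "f' x = indicator M x * (f x - a)" for x
  have f'_nonneg: "0 \<le> f' x" for x using f by (auto simp: f'_def indicator_def)
  have f'_borel: "f' \<in> borel_measurable borel"
    unfolding f'_def
    by (intro borel_measurable_indicator_times_continuous M continuous_intros f)
  define X where "X \<omega> = (\<Sum>x\<in>#G \<omega>. f' x)" for \<omega>
  have X_ennreal: "(\<Sum>x\<in>#G \<omega>. ennreal (f' x)) = ennreal (X \<omega>)" for \<omega>
    unfolding X_def by (rule sum_mset_ennreal) (rule f'_nonneg)
  have X_nonneg: "0 \<le> X \<omega>" for \<omega>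
    unfolding X_def by (rule sum_mset_nonneg) (rule f'_nonneg)
  have "(\<lambda>x. ennreal (f' x)) \<in> borel_measurable borel" using f'_borel by measurable
  note C = poisson_process_Campbell[OF pp M this, unfolded X_ennreal]
  have [measurable]: "X \<in> borel_measurable P"
  proof -
    have "X = (\<lambda>\<omega>. enn2real (ennreal (X \<omega>)))" using X_nonneg by auto
    also have "\<dots> \<in> borel_measurable P" using C by (intro measurable_compose[OF _ borel_measurable_enn2real]) auto
    finally show ?thesis .
  qed
  define N where "N \<omega> = real (point_count (G \<omega>) M)" for \<omega>
  have N: "integrable P N"
    unfolding N_def using pp M by (simp add: poisson_process_def has_bochner_integral_iff)
  have N_nonneg: "0 \<le> N \<omega>" for \<omega> by (simp add: N_def)
  have X_eq: "X \<omega> = (\<Sum>x\<in>#G \<omega>. f x) - a * N \<omega>" if "\<omega> \<in> space P" for \<omega>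
  proof -
    have "(\<Sum>x\<in>#H. f' x) = (\<Sum>x\<in>#H. f x) - a * real (point_count H M)" if "set_mset H \<subseteq> M" for H
      using that by (induction H) (auto simp: f'_def point_count_def algebra_simps)
    thus ?thesis using sub[OF that] by (simp add: X_def N_def)
  qed
  define W where "W \<omega> = X \<omega> + a * N \<omega> - c" for \<omega>
  have [measurable]: "N \<in> borel_measurable P" using N by (rule borel_measurable_integrable)
  have [measurable]: "W \<in> borel_measurable P" unfolding W_def by measurable
  have "(\<integral>\<^sup>+\<omega>. ennreal (W \<omega>) \<partial>P) < \<infinity>"
  proof (rule nn_integral_finite_of_exponential_tail[OF _ \<open>0 < K\<close>])
    fix \<rho> assume \<rho>: "K \<le> \<rho>"
    let ?Q = "{\<omega> \<in> space P. Q \<rho> \<omega>}"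
    \<comment> \<open>A non-measurable set has \<open>measure\<close> zero by convention, so the
      positive lower bound forces the event to be measurable.\<close>
    have "exp (- \<rho> / K) < 1" using \<rho> \<open>0 < K\<close> by simp
    hence "prob ?Q \<noteq> 0" using conc[OF \<rho>] by linarith
    hence Qm: "?Q \<in> events" using measure_notin_sets by blast
    have "prob {\<omega> \<in> space P. \<rho> < W \<omega>} \<le> prob (space P - ?Q)"
      using Qm Q[of \<rho>] by (intro finite_measure_mono) (force simp: W_def X_eq abs_le_iff)+
    also have "\<dots> \<le> exp (- \<rho> / K)" using conc[OF \<rho>] Qm by (simp add: prob_compl)
    finally show "prob {\<omega> \<in> space P. \<rho> < W \<omega>} \<le> exp (- \<rho> / K)" .
  qed simp
  moreover have "(\<integral>\<^sup>+\<omega>. ennreal (\<bar>c\<bar> + \<bar>a\<bar> * N \<omega>) \<partial>P) < \<infinity>"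
    using N N_nonneg by (subst nn_integral_eq_integral) auto
  ultimately have "(\<integral>\<^sup>+\<omega>. ennreal (W \<omega>) + ennreal (\<bar>c\<bar> + \<bar>a\<bar> * N \<omega>) \<partial>P) < \<infinity>"
    by (subst nn_integral_add) auto
  moreover have "(\<integral>\<^sup>+\<omega>. ennreal (X \<omega>) \<partial>P) \<le> (\<integral>\<^sup>+\<omega>. ennreal (W \<omega>) + ennreal (\<bar>c\<bar> + \<bar>a\<bar> * N \<omega>) \<partial>P)"
  proof (rule nn_integral_mono)
    fix \<omega>
    have "- (a * N \<omega>) \<le> \<bar>a\<bar> * N \<omega>" using N_nonneg by (metis abs_ge_minus_self minus_mult_left mult_right_mono)
    hence "X \<omega> \<le> max 0 (W \<omega>) + (\<bar>c\<bar> + \<bar>a\<bar> * N \<omega>)" by (simp add: W_def)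
    hence "ennreal (X \<omega>) \<le> ennreal (max 0 (W \<omega>) + (\<bar>c\<bar> + \<bar>a\<bar> * N \<omega>))" by (rule ennreal_leI)
    also have "\<dots> = ennreal (W \<omega>) + ennreal (\<bar>c\<bar> + \<bar>a\<bar> * N \<omega>)"
      using N_nonneg by (subst ennreal_plus) auto
    finally show "ennreal (X \<omega>) \<le> ennreal (W \<omega>) + ennreal (\<bar>c\<bar> + \<bar>a\<bar> * N \<omega>)" .
  qed
  ultimately have fin: "(\<integral>\<^sup>+x. ennreal (f' x) * ennreal (h x) \<partial>lebesgue_on M) < \<infinity>"
    using C by (auto dest: le_less_trans)
  have f'N: "f' \<in> borel_measurable (lebesgue_on M)"
    using f'_borel by (intro measurable_restrict_space1 measurable_completion) simp
  have "integrable (lebesgue_on M) (\<lambda>x. f' x * h x)"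
  proof (rule integrableI_nonneg)
    show "(\<lambda>x. f' x * h x) \<in> borel_measurable (lebesgue_on M)" using f'N hint by auto
    show "AE x in lebesgue_on M. 0 \<le> f' x * h x" using hpos by eventually_elim (simp add: f'_nonneg)
    show "(\<integral>\<^sup>+x. ennreal (f' x * h x) \<partial>lebesgue_on M) < \<infinity>"
      using fin by (simp add: ennreal_mult' f'_nonneg)
  qed
  hence "integrable (lebesgue_on M) (\<lambda>x. f' x * h x + a * h x)" using hint by simp
  thus ?thesis
    by (rule Bochner_Integration.integrable_cong[THEN iffD1, rotated 2])
      (auto simp: f'_def algebra_simps)
qed

text \<open>Writing \<open>ln (g + \<sigma>) = ln \<sigma> + ln (1 + g / \<sigma>)\<close> gives the
  majorant \<open>\<bar>ln \<sigma>\<bar> + g / \<sigma>\<close>, whose constant part is integrable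
  because \<open>M\<close> is bounded.\<close>

lemma integrable_ln_shift:
  fixes g :: "'a::euclidean_space \<Rightarrow> real"
  assumes "open M" "bounded M" "integrable (lebesgue_on M) g" "\<And>x. x \<in> M \<Longrightarrow> 0 \<le> g x" "0 < \<sigma>"
  shows "integrable (lebesgue_on M) (\<lambda>x. ln (g x + \<sigma>))"
proof -
  have "M \<in> lmeasurable" using assms by (intro lmeasurable_open)
  hence "finite_measure (lebesgue_on M)"
    by (rule finite_measure_lebesgue_on)
  hence bd: "integrable (lebesgue_on M) (\<lambda>x. \<bar>ln \<sigma>\<bar> + g x / \<sigma>)"
    using assms(3) by (auto intro: finite_measure.integrable_const)
  show ?thesis
  proof (rule Bochner_Integration.integrable_bound[OF bd])
    show "(\<lambda>x. ln (g x + \<sigma>)) \<in> borel_measurable (lebesgue_on M)" using assms(3) by measurable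
    show "AE x in lebesgue_on M. norm (ln (g x + \<sigma>)) \<le> norm (\<bar>ln \<sigma>\<bar> + g x / \<sigma>)"
    proof (rule AE_I2)
      fix x assume "x \<in> space (lebesgue_on M)"
      hence g: "0 \<le> g x" using assms by auto
      have "g x + \<sigma> = \<sigma> * (1 + g x / \<sigma>)" using assms(5) by (simp add: field_simps)
      moreover have "0 < 1 + g x / \<sigma>" using g assms(5) by (simp add: add_pos_nonneg)
      ultimately have "ln (g x + \<sigma>) = ln \<sigma> + ln (1 + g x / \<sigma>)"
        using assms(5) by (simp only: ln_mult_pos)
      moreover have "0 \<le> ln (1 + g x / \<sigma>)" "ln (1 + g x / \<sigma>) \<le> g x / \<sigma>"
        using g assms(5) by (auto intro: ln_add_one_self_le_self)
      ultimately show "norm (ln (g x + \<sigma>)) \<le> norm (\<bar>ln \<sigma>\<bar> + g x / \<sigma>)" by simp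
    qed
  qed
qed

subsection \<open>Convergence rate\<close>

theorem theorem5p1:
  fixes M :: "'a::euclidean_space set"
    and B :: "'x::banach set"
    and F :: "'x \<Rightarrow> 'a \<Rightarrow> real"
    and P :: "'w measure"
    and G :: "real \<Rightarrow> 'w \<Rightarrow> 'a multiset"
    and J :: "'x \<Rightarrow> ereal"
    and ustar :: "'x \<Rightarrow>\<^sub>L real"
    and \<phi> :: "real \<Rightarrow> real"
    and u :: "real \<Rightarrow> real \<Rightarrow> 'w \<Rightarrow> 'x"
    and u0 :: 'x
    and g0 :: "'a \<Rightarrow> real"
    and s R \<sigma> \<beta> Cbd q r \<tau> Cconc K :: real
    and err :: "real \<Rightarrow> 'w \<Rightarrow> real"
  assumes domain: "bounded_lipschitz_domain M"
    and B: "bounded B" "closed B" "convex B"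
    and F_L1: "\<And>v. v \<in> B \<Longrightarrow> integrable (lebesgue_on M) (F v)"
    and F_nonneg: "\<And>v. v \<in> B \<Longrightarrow> AE x in lebesgue_on M. 0 \<le> F v x"
    and s: "s > real DIM('a) / 2"
    and F_Hs: "\<And>v. v \<in> B \<Longrightarrow> F v \<in> sobolev_space M s"
    and F_continuous_rep: "\<And>v. v \<in> B \<Longrightarrow> continuous_on M (F v)"
    and F_bounded: "bdd_above ((\<lambda>v. sobolev_norm M s (F v)) ` B)"
    and R: "R = (SUP v\<in>B. sobolev_norm M s (F v))" "R > 0"
    and u0: "u0 \<in> B"
    and g0: "g0 = F u0"
    and \<sigma>: "\<sigma> > 0"
    and P: "prob_space P"
    and G: "\<And>t. t > 0 \<Longrightarrow> poisson_process P M (\<lambda>x. t * g0 x) (G t)"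
    and J: "proper_convex J"
    and ustar: "ustar \<in> subdifferential J u0"
    and \<beta>: "\<beta> \<ge> 1 / 2"
    and \<phi>: "index_function \<phi>" "concave_on {0..} (\<lambda>x. (\<phi> x)\<^sup>2)"
    and source_condition: "\<And>v. v \<in> B \<Longrightarrow>
          ereal \<beta> * bregman_distance J ustar v u0
            \<le> J v - J u0 + ereal (\<phi> (exact_fidelity M \<sigma> g0 (F v)))"
    and Cbd: "Cbd > 0" and q: "q \<ge> 1"
    and norm_bound: "\<And>v. v \<in> B \<Longrightarrow>
          ereal (norm (v - u0) powr q) \<le> ereal Cbd * bregman_distance J ustar v u0"
    and minimizer: "\<And>t \<alpha> \<omega>. t > 0 \<Longrightarrow> \<alpha> > 0 \<Longrightarrow> \<omega> \<in> space P \<Longrightarrow>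
          is_arg_min (\<lambda>v. ereal (data_fidelity M \<sigma> t (G t \<omega>) (F v)) + ereal \<alpha> * J v)
            (\<lambda>v. v \<in> B) (u t \<alpha> \<omega>)"
    and Cconc: "Cconc \<ge> 1"
    and K: "K = concentration_scale R \<sigma> s Cconc"
    and concentration: "\<And>t \<rho>. t \<ge> 1 \<Longrightarrow> \<rho> \<ge> K \<Longrightarrow>
          \<P>(\<omega> in P. (SUP v\<in>B. ereal (data_noise M \<sigma> g0 t (G t \<omega>) (F v))) \<le> ereal (\<rho> / sqrt t))
            \<ge> 1 - exp (- \<rho> / K)"
    and r: "r > 1"
    and \<tau>: "\<tau> \<ge> 1 / 4 * (R * max (\<sigma> powi (- \<lfloor>s\<rfloor> - 1)) \<bar>ln R\<bar> * Cconc)"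
    and err: "err = (\<lambda>t \<omega>.
          let m = max_index \<tau> r t;
              v = (\<lambda>j. u t (reg_param \<tau> r t j) \<omega>);
              j_bal = balancing_index Cbd q r m v
          in norm (v j_bal - u0) powr q)"
    and err_measurable: "\<And>t. t > 1 \<Longrightarrow> err t \<in> borel_measurable P"
  shows "(\<lambda>t. prob_space.expectation P (err t)) \<in> O[at_top](\<lambda>t. \<phi> (ln t / sqrt t))"
proof -

  \<comment> \<open>Positivity, integrability and boundedness\<close>
  interpret prob_space P by fact
  have M: "open M" "bounded M" using domain by (auto simp: bounded_lipschitz_domain_def)
  have nonneg: "0 \<le> F v x" if "v \<in> B" "x \<in> M" for v x
    using continuous_on_AE_nonneg_imp_nonneg[OF M(1) F_continuous_rep F_nonneg] that by blast
  have K_pos: "0 < K"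
    using R(2) \<sigma> Cconc unfolding K concentration_scale_def
    by (intro mult_pos_pos) (auto simp: less_max_iff_disj)
  have \<tau>K: "K \<le> 4 * \<tau>" using \<tau> by (simp add: K concentration_scale_def)
  have \<tau>_pos: "0 < \<tau>" using \<tau>K K_pos by linarith

  have noise_le: "data_noise M \<sigma> g0 t H (F v) \<le> c"
    if "(SUP v\<in>B. ereal (data_noise M \<sigma> g0 t H (F v))) \<le> ereal c" "v \<in> B" for t H v c
    using that by (simp add: SUP_le_iff)
  have int_ln: "integrable (lebesgue_on M) (\<lambda>x. ln (F v x + \<sigma>))" if "v \<in> B" for v
    by (rule integrable_ln_shift[OF M F_L1[OF that] nonneg[OF that] \<sigma>])
  \<comment> \<open>A Campbell argument replaces the Sobolev embedding: by concentration the Poisson sum of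
    \<open>ln (F v + \<sigma>)\<close> has finite expectation, and that expectation is the integral in question.\<close>
  have int_ln_g0: "integrable (lebesgue_on M) (\<lambda>x. ln (F v x + \<sigma>) * g0 x)" if v: "v \<in> B" for v
  proof (rule poisson_process_Campbell_integrable[OF P _ M(1)])
    show "poisson_process P M g0 (G 1)" using G[of 1] by simp
    show "continuous_on M (\<lambda>x. ln (F v x + \<sigma>))"
      using F_continuous_rep[OF v] nonneg[OF v] \<sigma>
      by (intro continuous_intros) (auto simp: add_nonneg_eq_0_iff)
    show "ln \<sigma> \<le> ln (F v x + \<sigma>)" if "x \<in> M" for x using nonneg[OF v that] \<sigma> by simp
    show "0 < K" by fact
    show "1 - exp (- \<rho> / K) \<le> \<P>(\<omega> in P. (SUP v\<in>B. ereal (data_noise M \<sigma> g0 1 (G 1 \<omega>) (F v))) \<le> ereal \<rho>)"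
      if "K \<le> \<rho>" for \<rho> using concentration[of 1 \<rho>] that by simp
    show "\<bar>(\<Sum>x\<in>#G 1 \<omega>. ln (F v x + \<sigma>)) - (\<integral>x. ln (F v x + \<sigma>) * g0 x \<partial>lebesgue_on M)\<bar> \<le> \<rho>"
      if "(SUP v\<in>B. ereal (data_noise M \<sigma> g0 1 (G 1 \<omega>) (F v))) \<le> ereal \<rho>" for \<rho> \<omega>
      using noise_le[OF that v] by (simp add: data_noise_def scaled_integral_def)
  qed

  have u_B: "u t \<alpha> \<omega> \<in> B" if "0 < t" "0 < \<alpha>" "\<omega> \<in> space P" for t \<alpha> \<omega>
    using minimizer[OF that] by (simp add: is_arg_min_def)
  obtain b where b: "\<And>v. v \<in> B \<Longrightarrow> norm v \<le> b" using B(1) by (auto simp: bounded_iff)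
  \<comment> \<open>Every minimizer lies in \<open>B\<close>, so \<open>D\<close> bounds the error
    whichever index is selected; this serves the exceptional event.\<close>
  define D where "D = (2 * b) powr q"
  have D: "norm (v - u0) powr q \<le> D" if "v \<in> B" for v
    using norm_triangle_ineq4[of v u0] b[OF that] b[OF u0] q unfolding D_def by (intro powr_mono2) auto
  have D_nonneg: "0 \<le> D" by (simp add: D_def)

  have err_D: "err t \<omega> \<le> D" if "1 < t" "\<omega> \<in> space P" for t \<omega>
    using D[OF u_B[OF _ reg_param_pos[OF \<tau>_pos r]]] that by (simp add: err Let_def)
  have err_nonneg: "0 \<le> err t \<omega>" for t \<omega> by (simp add: err Let_def)

  \<comment> \<open>Error of a single minimizer on the good event\<close>
  have good_error: "norm (u t \<alpha> \<omega> - u0) powr q \<le> 2 * (4 * Cbd) * (\<tau> * \<delta> / \<alpha>)"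
    if sup: "(SUP v\<in>B. ereal (data_noise M \<sigma> g0 t (G t \<omega>) (F v))) \<le> ereal (\<tau> * \<delta>)"
      and t: "0 < t" and \<alpha>: "0 < \<alpha>" and \<omega>: "\<omega> \<in> space P" and \<delta>: "0 < \<delta>"
      and \<alpha>_le: "\<alpha> * \<phi> \<delta> \<le> \<delta>" "\<alpha> * \<phi> \<delta> \<le> (2 * \<tau>) * \<delta>" for t \<alpha> \<omega> \<delta>
  proof -
    define v where "v = u t \<alpha> \<omega>"
    have v: "v \<in> B" using u_B[OF t \<alpha> \<omega>] by (simp add: v_def)
    define T where "T = exact_fidelity M \<sigma> g0 (F v)"
    define S where "S w = data_fidelity M \<sigma> t (G t \<omega>) (F w)" for w
    have T_nonneg: "0 \<le> T"
      unfolding T_def g0 by (rule exact_fidelity_nonneg[OF \<sigma> nonneg[OF u0] nonneg[OF v]])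
    have "T \<le> S v - S u0 + data_noise M \<sigma> g0 t (G t \<omega>) (F v) + data_noise M \<sigma> g0 t (G t \<omega>) (F u0)"
      unfolding T_def S_def
      using exact_fidelity_le[of \<sigma> M g0 "F v" t "G t \<omega>"] \<sigma> nonneg[OF u0] nonneg[OF v]
        F_L1[OF u0] F_L1[OF v] int_ln[OF u0] int_ln[OF v] int_ln_g0[OF u0] int_ln_g0[OF v]
      by (simp add: g0)
    also have "\<dots> \<le> S v - S u0 + \<tau> * \<delta> + \<tau> * \<delta>"
      by (intro add_mono noise_le[OF sup] u0 v order_refl)
    finally have T_le: "T \<le> S v - S u0 + 2 * (\<tau> * \<delta>)" by linarith
    have min: "ereal (S v) + ereal \<alpha> * J v \<le> ereal (S u0) + ereal \<alpha> * J u0"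
      using minimizer[OF t \<alpha> \<omega>] u0 by (auto simp: is_arg_min_def S_def v_def not_less)
    \<comment> \<open>The noise at \<open>v\<close> and at \<open>u0\<close> gives
      \<open>N = 2 * (\<tau> * \<delta>)\<close>, and the conjugate bound contributes the same
      amount again. The total is written with the factor \<open>4 * Cbd\<close> of the balancing
      rule.\<close>
    have "norm (v - u0) powr q \<le> 2 * Cbd * (2 * (\<tau> * \<delta>) / \<alpha> + (\<phi> T - T / \<alpha>))"
      by (rule minimizer_error_bound[where \<phi> = \<phi> and T = T, OF J ustar \<beta> \<alpha> min source_condition[OF v, folded T_def]
          norm_bound[OF v] Cbd T_le])
    also have "\<phi> T - T / \<alpha> \<le> 2 * \<tau> * \<delta> / \<alpha>"
      by (rule index_function_conjugate_bound[OF \<phi> \<delta> \<alpha> \<alpha>_le T_nonneg])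
    finally show ?thesis using Cbd by (simp add: v_def algebra_simps)
  qed

  \<comment> \<open>The oracle index is the largest \<open>j\<close> with \<open>\<alpha>\<^sub>j \<le> c1 * \<delta> / \<phi> \<delta>\<close>; the factor \<open>2 * \<tau>\<close> in
    \<open>c1\<close> makes the approximation error at most the noise level there.\<close>
  define c1 where "c1 = min 1 (2 * \<tau>)"
  have c1: "0 < c1" "c1 \<le> 1" "c1 \<le> 2 * \<tau>" using \<tau>_pos by (auto simp: c1_def)
  \<comment> \<open>The first summand is the Lepskii bound at the oracle index; the second covers
    the case in which the first grid point is already too large.\<close>
  define C where "C = 6 powr q * (4 * Cbd) * (\<tau> * r\<^sup>2 / c1) + D * \<tau> / c1"
  have C_parts: "0 \<le> 6 powr q * (4 * Cbd) * (\<tau> * r\<^sup>2 / c1)" "0 \<le> D * \<tau> / c1"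
    using c1 Cbd \<tau>_pos D_nonneg by auto

  obtain c y where c: "0 < c" and y: "0 < y"
    and c_sqrt: "\<And>x. 0 < x \<Longrightarrow> x \<le> y \<Longrightarrow> c * sqrt x \<le> \<phi> x"
    using index_function_sqrt_lower_bound[OF \<phi>] by metis

  \<comment> \<open>Error of the balanced choice on the good event\<close>
  have good_err: "err t \<omega> \<le> C * \<phi> \<delta>"
    if sup: "(SUP v\<in>B. ereal (data_noise M \<sigma> g0 t (G t \<omega>) (F v))) \<le> ereal (\<tau> * \<delta>)"
      and t: "1 < t" and \<omega>: "\<omega> \<in> space P" and \<delta>_def: "\<delta> = ln t / sqrt t"
      and \<delta>_le: "\<delta> < \<phi> \<delta>" for t \<omega> \<delta>
  proof -
    have \<delta>: "0 < \<delta>" using t by (simp add: \<delta>_def)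
    hence \<phi>\<delta>: "0 < \<phi> \<delta>" using \<delta>_le by linarith
    let ?\<alpha> = "reg_param \<tau> r t"
    note \<alpha>_pos = reg_param_pos[OF \<tau>_pos r t]
    define A where "A = c1 * \<delta> / \<phi> \<delta>"
    have A: "0 < A" using c1 \<delta> \<phi>\<delta> by (simp add: A_def)
    show ?thesis
    proof (cases "?\<alpha> 1 \<le> A")
      \<comment> \<open>Here \<open>\<phi> \<delta>\<close> exceeds \<open>c1 / \<tau>\<close>, so
        the trivial bound \<open>D\<close> is already of order
        \<open>\<phi> \<delta>\<close>.\<close>
      case False
      hence "c1 * \<delta> / \<phi> \<delta> < \<tau> * \<delta>" by (simp add: reg_param_def A_def \<delta>_def)
      hence "\<delta> * c1 < \<delta> * (\<tau> * \<phi> \<delta>)" using \<phi>\<delta> by (simp add: pos_divide_less_eq mult_ac)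
      hence "c1 < \<tau> * \<phi> \<delta>" using \<delta> by simp
      hence "1 \<le> \<tau> / c1 * \<phi> \<delta>" using c1 by (simp add: pos_le_divide_eq)
      hence "D * 1 \<le> D * (\<tau> / c1 * \<phi> \<delta>)" using D_nonneg by (intro mult_left_mono)
      also have "\<dots> \<le> C * \<phi> \<delta>"
        using mult_right_mono[OF C_parts(1), of "\<phi> \<delta>"] \<phi>\<delta> by (simp add: C_def distrib_right)
      finally show ?thesis using err_D[OF t \<omega>] by simp
    next
      case True
      obtain j where j: "1 \<le> j" "?\<alpha> j \<le> A" "A < r\<^sup>2 * ?\<alpha> j"
        by (rule reg_param_bracket[OF \<tau>_pos r t True])
      \<comment> \<open>With \<open>\<delta> < \<phi> \<delta>\<close> this gives
        \<open>A < 1\<close>, which keeps the oracle index within the range searched by the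
        balancing rule.\<close>
      have "c1 * \<delta> \<le> 1 * \<delta>" using c1 \<delta> by (intro mult_right_mono) auto
      hence "A < 1" using \<delta>_le \<phi>\<delta> by (simp add: A_def)
      hence "j \<le> max_index \<tau> r t" using j by (intro le_max_index[OF \<tau>_pos r t]) auto
      hence j_in: "j \<in> {1..max_index \<tau> r t}" using j by simp
      define \<Psi> where "\<Psi> i = (4 * Cbd) powr (1 / q) * r powr ((2 - 2 * real i) / q)" for i
      \<comment> \<open>Because
        \<open>\<alpha>\<^sub>i = \<tau> * \<delta> * r ^ (2 * i - 2)\<close>, the threshold of the
        balancing rule is the \<open>q\<close>-th root of the noise part of the error.\<close>
      have \<Psi>_powr: "\<Psi> i powr q = 4 * Cbd * (\<tau> * \<delta> / ?\<alpha> i)" if "1 \<le> i" for i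
      proof -
        have "r powr (2 - 2 * real i) = inverse (r powr real (2 * i - 2))"
          using that by (simp add: powr_minus[symmetric] of_nat_diff)
        also have "\<dots> = inverse (r ^ (2 * i - 2))" using r by (subst powr_realpow) auto
        also have "\<dots> = \<tau> * \<delta> / ?\<alpha> i"
        proof -
          have "?\<alpha> i = (\<tau> * \<delta>) * r ^ (2 * i - 2)" by (simp add: reg_param_def \<delta>_def)
          thus ?thesis using \<tau>_pos \<delta> by (simp add: inverse_eq_divide)
        qed
        finally show ?thesis
          using q Cbd by (simp add: \<Psi>_def powr_mult powr_powr)
      qed
      have \<Psi>_nonneg: "0 \<le> \<Psi> i" for i by (simp add: \<Psi>_def)
      define v where "v i = u t (?\<alpha> i) \<omega>" for i
      have v_err: "norm (v i - u0) \<le> 2 * \<Psi> i" if "i \<in> {1..j}" for i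
      proof -
        have "?\<alpha> i \<le> A" using reg_param_mono[OF \<tau>_pos r t, of i j] that j by simp
        hence \<alpha>_le: "?\<alpha> i * \<phi> \<delta> \<le> c1 * \<delta>" using \<phi>\<delta> by (simp add: A_def pos_le_divide_eq)
        have "c1 * \<delta> \<le> 2 * \<tau> * \<delta>" using c1 \<delta> by (intro mult_right_mono) auto
        hence "norm (v i - u0) powr q \<le> 2 * (4 * Cbd) * (\<tau> * \<delta> / ?\<alpha> i)"
          unfolding v_def using \<alpha>_le \<open>c1 * \<delta> \<le> 1 * \<delta>\<close> t
          by (intro good_error[OF sup _ \<alpha>_pos \<omega> \<delta>]) auto
        also have "\<dots> = 2 * \<Psi> i powr q" using \<Psi>_powr that by simp
        \<comment> \<open>As \<open>q \<ge> 1\<close>, the factor \<open>2\<close> can be moved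
          inside the power, giving the form that the Lepskii lemma expects.\<close>
        also have "\<dots> \<le> 2 powr q * \<Psi> i powr q"
          using powr_mono[of 1 q 2] q by (intro mult_right_mono) auto
        also have "\<dots> = (2 * \<Psi> i) powr q" using \<Psi>_nonneg by (simp add: powr_mult)
        finally show ?thesis
          using powr_less_mono2[of q "2 * \<Psi> i" "norm (v i - u0)"] q \<Psi>_nonneg[of i] by force
      qed
      define k where "k = balancing_index Cbd q r (max_index \<tau> r t) v"
      have "norm (v k - u0) \<le> 6 * \<Psi> j"
        unfolding k_def \<Psi>_def
        by (rule balancing_index_error[OF _ q j_in]) (use r v_err in \<open>auto simp: \<Psi>_def\<close>)
      hence "norm (v k - u0) powr q \<le> (6 * \<Psi> j) powr q" using q by (intro powr_mono2) auto
      also have "\<dots> = 6 powr q * (4 * Cbd) * (\<tau> * \<delta> / ?\<alpha> j)"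
        using \<Psi>_nonneg \<Psi>_powr j by (simp add: powr_mult)
      also have "\<dots> \<le> 6 powr q * (4 * Cbd) * (\<tau> * r\<^sup>2 / c1 * \<phi> \<delta>)"
      proof (rule mult_left_mono)
        \<comment> \<open>The upper bracket \<open>A < r^2 * \<alpha>\<^sub>j\<close> enters here:
          the oracle parameter is not too small, so the noise term is of order
          \<open>\<phi> \<delta>\<close>.\<close>
        have "c1 * \<delta> \<le> r\<^sup>2 * ?\<alpha> j * \<phi> \<delta>"
          using j(3) \<phi>\<delta> by (simp add: A_def pos_divide_less_eq)
        hence "\<delta> / ?\<alpha> j \<le> r\<^sup>2 / c1 * \<phi> \<delta>"
          using c1 \<alpha>_pos[of j] by (simp add: field_simps)
        hence "\<tau> * (\<delta> / ?\<alpha> j) \<le> \<tau> * (r\<^sup>2 / c1 * \<phi> \<delta>)" using \<tau>_pos by (intro mult_left_mono) auto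
        thus "\<tau> * \<delta> / ?\<alpha> j \<le> \<tau> * r\<^sup>2 / c1 * \<phi> \<delta>" by simp
      qed (use Cbd in auto)
      also have "\<dots> \<le> C * \<phi> \<delta>"
        using mult_right_mono[OF C_parts(2), of "\<phi> \<delta>"] \<phi>\<delta> by (simp add: C_def distrib_right)
      finally show ?thesis by (simp add: err Let_def k_def v_def[abs_def])
    qed
  qed

  \<comment> \<open>Expectation over the good and the exceptional event\<close>
  have main: "expectation (err t) \<le> (C + D / c) * \<phi> (ln t / sqrt t)"
    if t: "exp 4 \<le> t" and small: "ln t / sqrt t < min y (c\<^sup>2)" for t
  proof -
    define \<delta> where "\<delta> = ln t / sqrt t"
    have t0: "0 < t" using t less_le_trans[OF exp_gt_zero] by blast
    have ln_t: "4 \<le> ln t" using t t0 by (simp add: ln_ge_iff)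
    hence t1: "1 < t" using t0 by (metis ln_gt_zero_iff less_le_trans zero_less_numeral)
    have \<delta>: "0 < \<delta>" "\<delta> \<le> y" "\<delta> < c\<^sup>2" using small t1 by (auto simp: \<delta>_def)
    have \<phi>\<delta>: "c * sqrt \<delta> \<le> \<phi> \<delta>" by (rule c_sqrt[OF \<delta>(1,2)])
    \<comment> \<open>The threshold \<open>c^2\<close> is chosen so that
      \<open>\<delta> < c * sqrt \<delta> \<le> \<phi> \<delta>\<close>.\<close>
    have "sqrt \<delta> < c" using \<delta>(3) c by (metis real_sqrt_less_iff real_sqrt_unique less_imp_le)
    hence "sqrt \<delta> * sqrt \<delta> < c * sqrt \<delta>" using \<delta>(1) by (intro mult_strict_right_mono) auto
    hence \<delta>_lt: "\<delta> < \<phi> \<delta>" using \<phi>\<delta> \<delta>(1) by simp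
    define Good where "Good = {\<omega> \<in> space P.
      (SUP v\<in>B. ereal (data_noise M \<sigma> g0 t (G t \<omega>) (F v))) \<le> ereal (\<tau> * \<delta>)}"
    \<comment> \<open>The threshold \<open>exp 4\<close> makes \<open>\<rho> = \<tau> * ln t\<close>
      admissible in the concentration inequality.\<close>
    have "K \<le> \<tau> * 4" using \<tau>K by simp
    also have "\<dots> \<le> \<tau> * ln t" using ln_t \<tau>_pos by (intro mult_left_mono) auto
    finally have "K \<le> \<tau> * ln t" .
    hence prob_Good: "1 - exp (- (\<tau> * ln t) / K) \<le> prob Good"
      using concentration[of t "\<tau> * ln t"] t1 by (simp add: Good_def \<delta>_def)
    \<comment> \<open>As before, positive \<open>prob\<close> yields measurability of
      \<open>Good\<close>.\<close>
    have "exp (- (\<tau> * ln t) / K) < 1" using K_pos \<tau>_pos t1 by simp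
    hence "prob Good \<noteq> 0" using prob_Good by linarith
    hence Good [measurable]: "Good \<in> events" using measure_notin_sets by blast
    \<comment> \<open>\<open>K \<le> 4 * \<tau>\<close> gives the exponent \<open>1 / 4\<close>: the bad event has probability at most
      \<open>t powr (- 1 / 4)\<close>, which \<open>sqrt \<delta>\<close> dominates.\<close>
    have "exp (- (\<tau> * ln t) / K) \<le> sqrt \<delta>"
    proof -
      have "K * ln t \<le> 4 * \<tau> * ln t" using \<tau>K ln_t by (intro mult_right_mono) auto
      hence "- (\<tau> * ln t) / K \<le> - ln t / 4" using K_pos by (simp add: field_simps)
      also have "\<dots> \<le> (ln (ln t) - ln t / 2) / 2" using ln_t by (simp add: field_simps)
      also have "\<dots> = ln (sqrt \<delta>)"
        using t1 \<delta>(1) by (simp add: \<delta>_def ln_sqrt ln_div)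
      finally have "exp (- (\<tau> * ln t) / K) \<le> exp (ln (sqrt \<delta>))" by simp
      thus ?thesis using \<delta>(1) by simp
    qed
    also have "sqrt \<delta> \<le> \<phi> \<delta> / c" using \<phi>\<delta> c by (simp add: field_simps)
    finally have bad: "prob (space P - Good) \<le> \<phi> \<delta> / c"
      using prob_Good Good by (simp add: prob_compl)
    have int_err: "integrable P (err t)"
      using err_measurable[OF t1] err_D[OF t1] err_nonneg by (intro integrable_const_bound[of _ D]) auto
    have "expectation (err t) \<le> expectation (\<lambda>\<omega>. C * \<phi> \<delta> + D * indicator (space P - Good) \<omega>)"
    proof (rule integral_mono[OF int_err])
      show "integrable P (\<lambda>\<omega>. C * \<phi> \<delta> + D * indicator (space P - Good) \<omega>)"
        using Good by (auto simp: emeasure_eq_measure)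
      fix \<omega> assume \<omega>: "\<omega> \<in> space P"
      show "err t \<omega> \<le> C * \<phi> \<delta> + D * indicator (space P - Good) \<omega>"
      proof (cases "\<omega> \<in> Good")
        case True
        thus ?thesis using good_err[OF _ t1 \<omega> \<delta>_def \<delta>_lt] by (simp add: Good_def)
      next
        case False
        have "0 \<le> C * \<phi> \<delta>" using C_parts \<delta>(1) \<delta>_lt by (simp add: C_def)
        thus ?thesis using False \<omega> err_D[OF t1 \<omega>] by simp
      qed
    qed
    also have "\<dots> = C * \<phi> \<delta> + D * prob (space P - Good)"
      using Good by (simp add: emeasure_eq_measure prob_space)
    also have "\<dots> \<le> C * \<phi> \<delta> + D * (\<phi> \<delta> / c)"
      by (intro add_left_mono mult_left_mono bad D_nonneg)
    finally show ?thesis by (simp add: \<delta>_def algebra_simps)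
  qed
  have lim: "((\<lambda>t::real. ln t / sqrt t) \<longlongrightarrow> 0) at_top" by real_asymp
  show ?thesis
  proof (rule bigoI)
    have "0 < min y (c\<^sup>2)" using y c by simp
    from order_tendstoD(2)[OF lim this]
    show "\<forall>\<^sub>F t in at_top. norm (expectation (err t)) \<le> (C + D / c) * norm (\<phi> (ln t / sqrt t))"
      using eventually_ge_at_top[of "exp 4"]
    proof eventually_elim
      case (elim t)
      have "0 \<le> expectation (err t)" by (intro Bochner_Integration.integral_nonneg err_nonneg)
      moreover have "0 \<le> C + D / c" using C_parts D_nonneg c by (simp add: C_def)
      hence "(C + D / c) * \<phi> (ln t / sqrt t) \<le> (C + D / c) * norm (\<phi> (ln t / sqrt t))"
        by (intro mult_left_mono) auto
      ultimately show ?case using main[OF elim(2,1)] by simp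
    qed
  qed
qed

end
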